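(* For every prime $p>2$ there is no minion homomorphism $\mathcal V_2\text{-}\mathbb Z_p\to\mathcal Z_{p^2}$.
   Context: A minion $\mathcal R$ is a functor from finite sets to sets: it assigns a set $\mathcal R^{(D)}$ to each finite set $D$ and a map $\mathcal R^{(\alpha)}:\mathcal R^{(D)}\to\mathcal R^{(E)}$ to each function $\alpha:D\to E$ between finite sets, preserving identities and composition. A minion homomorphism $\xi:\mathcal R\to\mathcal S$ is a natural transformation: a family of functions $\xi^{(D)}:\mathcal R^{(D)}\to\mathcal S^{(D)}$ with $\xi^{(E)}\circ\mathcal R^{(\alpha)}=\mathcal S^{(\alpha)}\circ\xi^{(D)}$ for every $\alpha:D\to E$. For $m\in\mathbb N$, the minion $\mathcal Z_m$ is given by $\mathcal Z_m^{(D)}=\{f:D\to\mathbb Z_m\mid\sum_{a\in D}f(a)=1\}$ (where $\mathbb Z_m$ is the ring of integers modulo $m$), and for $\alpha:D\to E$, $\mathcal Z_m^{(\alpha)}(f)(b)=\sum_{a\in\alpha^{-1}(b)}f(a)$. For a prime $p$, the minion $\mathcal V_2\text{-}\mathbb Z_p$ is defined as follows; all computations are in the field $\mathbb Z_p$. For vectors in $\mathbb Z_p^N$ let $\mathfrak w(v_1,\dots,v_N)=v_1+\cdots+v_N$ and let $\odot$ denote the componentwise product. For a finite set $D$, $(\mathcal V_2\text{-}\mathbb Z_p)^{(D)}$ is the set of triples $(V,\mathbf i,\mathbf v)$ where $V$ is a linear subspace of $\mathbb Z_p^N$ for some $N\in\mathbb N$, $\mathbf i\in V$, and $\mathbf v:D\to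 V$, such that: (i) $\mathbf i=(1,1,\dots,1)$ and $\mathfrak w(\mathbf i)=1$; (s) $\sum_{a\in D}\mathbf v(a)=\mathbf i$; (o) $\mathfrak w(\mathbf v(a)\odot\mathbf v(b))=0$ for all $a\ne b$ in $D$; (p) $\mathfrak w(\mathbf v(a)\odot\mathbf v(a))=\mathfrak w(\mathbf v(a))$ for all $a\in D$. For $\alpha:D\to E$, $(\mathcal V_2\text{-}\mathbb Z_p)^{(\alpha)}(V,\mathbf i,\mathbf v)=(V,\mathbf i,\mathbf v')$ with $\mathbf v'(b)=\sum_{a\in\alpha^{-1}(b)}\mathbf v(a)$. *)

theory Defs
  imports "HOL-Number_Theory.Number_Theory" "HOL-Algebra.Module"
    "HOL-Library.Infinite_Typeclass"
begin

section \<open>Minions\<close>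

text \<open>
  The category of finite sets is represented by the finite subsets of a type \<open>'a\<close>, which has
  to be infinite in order to contain sets of every finite cardinality. Since every finite set is in
  bijection with such a subset, this full subcategory is equivalent to the whole category, and
  restricting to it preserves and reflects the existence of natural transformations.
  The elements of all \<open>obj R D\<close> live in one type \<open>'r\<close>. The map assigned to \<open>\<alpha> : D \<rightarrow> E\<close>
  is \<open>act R D E \<alpha>\<close>. Functions between finite sets are extensional, so that they are equal
  in HOL iff they are equal as set-theoretic functions.
\<close>

record ('a, 'r) minion_data =
  obj :: "'a set \<Rightarrow> 'r set"
  act :: "'a set \<Rightarrow> 'a set \<Rightarrow> ('a \<Rightarrow> 'a) \<Rightarrow> 'r \<Rightarrow> 'r"

locale minion =
  fixes R :: "('a, 'r) minion_data"
  assumes act_closed: "\<lbrakk>finite D; finite E; \<alpha> \<in> D \<rightarrow>\<^sub>E E; r \<in> obj R D\<rbrakk> \<Longrightarrow> act R D E \<alpha> r \<in> obj R E"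
    and act_id: "\<lbrakk>finite D; r \<in> obj R D\<rbrakk> \<Longrightarrow> act R D D (\<lambda>a\<in>D. a) r = r"
    and act_compose: "\<lbrakk>finite D; finite E; finite F; \<alpha> \<in> D \<rightarrow>\<^sub>E E; \<beta> \<in> E \<rightarrow>\<^sub>E F; r \<in> obj R D\<rbrakk>
      \<Longrightarrow> act R D F (compose D \<beta> \<alpha>) r = act R E F \<beta> (act R D E \<alpha> r)"

definition minion_hom ::
    "('a, 'r) minion_data \<Rightarrow> ('a, 's) minion_data \<Rightarrow> ('a set \<Rightarrow> 'r \<Rightarrow> 's) \<Rightarrow> bool" where
  "minion_hom R S \<xi> \<longleftrightarrow>
     (\<forall>D. finite D \<longrightarrow> \<xi> D \<in> obj R D \<rightarrow> obj S D) \<and>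
     (\<forall>D E \<alpha> r. finite D \<and> finite E \<and> \<alpha> \<in> D \<rightarrow>\<^sub>E E \<and> r \<in> obj R D \<longrightarrow>
        \<xi> E (act R D E \<alpha> r) = act S D E \<alpha> (\<xi> D r))"

definition fibre_sum ::
    "('b, 'm) ring_scheme \<Rightarrow> 'a set \<Rightarrow> 'a set \<Rightarrow> ('a \<Rightarrow> 'a) \<Rightarrow> ('a \<Rightarrow> 'b) \<Rightarrow> 'a \<Rightarrow> 'b" where
  "fibre_sum G D E \<alpha> f = (\<lambda>b\<in>E. \<Oplus>\<^bsub>G\<^esub>a\<in>{a \<in> D. \<alpha> a = b}. f a)"

section \<open>The minion of affine maps to the integers modulo \<open>m\<close>\<close>

text \<open>
  The sum is compared with \<open>1 mod m\<close> because the constant \<open>\<one>\<close> of \<open>residue_ring\<close> is the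
  integer 1 even for \<open>m = 1\<close>, where it is not in the carrier.
\<close>

definition Z_minion :: "nat \<Rightarrow> ('a, 'a \<Rightarrow> int) minion_data" where
  "Z_minion m = (let R = residue_ring (int m) in
     \<lparr>obj = \<lambda>D. {f \<in> D \<rightarrow>\<^sub>E carrier R. (\<Oplus>\<^bsub>R\<^esub>a\<in>D. f a) = 1 mod int m},
      act = \<lambda>D E \<alpha> f. fibre_sum R D E \<alpha> f\<rparr>)"

section \<open>The minion \<open>V\<^sub>2-Z\<^sub>p\<close>\<close>

text \<open>
  The coordinate space \<open>Z\<^sub>p\<^sup>N\<close>, with coordinates indexed by \<open>0, \<dots>, N - 1\<close>. Its
  ring multiplication is the componentwise product, hence its ring unit is the all-ones vector.
\<close>

definition coord_space :: "nat \<Rightarrow> nat \<Rightarrow> (int, nat \<Rightarrow> int) module" where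
  "coord_space p N = (let R = residue_ring (int p) in
     \<lparr>carrier = {..<N} \<rightarrow>\<^sub>E carrier R,
      monoid.mult = \<lambda>u v. \<lambda>j\<in>{..<N}. u j \<otimes>\<^bsub>R\<^esub> v j,
      one = \<lambda>j\<in>{..<N}. \<one>\<^bsub>R\<^esub>,
      zero = \<lambda>j\<in>{..<N}. \<zero>\<^bsub>R\<^esub>,
      add = \<lambda>u v. \<lambda>j\<in>{..<N}. u j \<oplus>\<^bsub>R\<^esub> v j,
      smult = \<lambda>c v. \<lambda>j\<in>{..<N}. c \<otimes>\<^bsub>R\<^esub> v j\<rparr>)"

definition weight :: "nat \<Rightarrow> nat \<Rightarrow> (nat \<Rightarrow> int) \<Rightarrow> int" where
  "weight p N v = (\<Oplus>\<^bsub>residue_ring (int p)\<^esub>j\<in>{..<N}. v j)"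

text \<open>
  An element is a tuple \<open>(N, V, i, v)\<close>. The number \<open>N\<close> is not extra data: \<open>V\<close>
  contains the zero vector and the all-ones vector, which differ exactly at the arguments below \<open>N\<close>.
  It is recorded only to make the ambient space of \<open>V\<close> available. The definition is meant for
  prime \<open>p\<close>; submodules over \<open>residue_ring p\<close> are then linear subspaces.
\<close>

type_synonym 'a V2_elem = "nat \<times> (nat \<Rightarrow> int) set \<times> (nat \<Rightarrow> int) \<times> ('a \<Rightarrow> nat \<Rightarrow> int)"

definition V2_set :: "nat \<Rightarrow> 'a set \<Rightarrow> 'a V2_elem set" where
  "V2_set p D = {(N, V, i, v).
     let W = coord_space p N; w = weight p N in
       submodule V (residue_ring (int p)) W \<and> i \<in> V \<and> v \<in> D \<rightarrow>\<^sub>E V \<and>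
       i = \<one>\<^bsub>W\<^esub> \<and> w i = 1 \<and>
       (\<Oplus>\<^bsub>W\<^esub>a\<in>D. v a) = i \<and>
       (\<forall>a\<in>D. \<forall>b\<in>D. a \<noteq> b \<longrightarrow> w (v a \<otimes>\<^bsub>W\<^esub> v b) = 0) \<and>
       (\<forall>a\<in>D. w (v a \<otimes>\<^bsub>W\<^esub> v a) = w (v a))}"

definition V2_minion :: "nat \<Rightarrow> ('a, 'a V2_elem) minion_data" where
  "V2_minion p =
     \<lparr>obj = V2_set p,
      act = \<lambda>D E \<alpha> (N, V, i, v). (N, V, i, fibre_sum (coord_space p N) D E \<alpha> v)\<rparr>"

section \<open>Both are minions\<close>

context abelian_monoid
begin

lemma fibre_sum_closed:
  assumes "f \<in> D \<rightarrow> carrier G"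
  shows "fibre_sum G D E \<alpha> f \<in> E \<rightarrow>\<^sub>E carrier G"
  using assms unfolding fibre_sum_def by (auto intro!: finsum_closed)

lemma finsum_fibre_sum:
  assumes "finite D" "finite E" "\<alpha> \<in> D \<rightarrow> E" "f \<in> D \<rightarrow> carrier G" "B \<subseteq> E"
  shows "(\<Oplus>b\<in>B. fibre_sum G D E \<alpha> f b) = (\<Oplus>a\<in>{a \<in> D. \<alpha> a \<in> B}. f a)"
proof -
  have eq: "{a \<in> D. \<alpha> a \<in> B} = (\<Union>b\<in>B. {a \<in> D. \<alpha> a = b})" by auto
  have "(\<Oplus>a\<in>(\<Union>b\<in>B. {a \<in> D. \<alpha> a = b}). f a) = (\<Oplus>b\<in>B. \<Oplus>a\<in>{a \<in> D. \<alpha> a = b}. f a)"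
    by (rule add.finprod_UN_disjoint)
       (use assms finite_subset[of B E] in \<open>auto simp: pairwise_def disjnt_def\<close>)
  also have "\<dots> = (\<Oplus>b\<in>B. fibre_sum G D E \<alpha> f b)"
    by (rule finsum_cong') (use assms in \<open>auto simp: fibre_sum_def intro!: finsum_closed\<close>)
  finally show ?thesis by (simp add: eq)
qed

lemma finsum_fibre_sum_all:
  assumes "finite D" "finite E" "\<alpha> \<in> D \<rightarrow> E" "f \<in> D \<rightarrow> carrier G"
  shows "(\<Oplus>b\<in>E. fibre_sum G D E \<alpha> f b) = (\<Oplus>a\<in>D. f a)"
proof -
  have "{a \<in> D. \<alpha> a \<in> E} = D" using assms by auto
  then show ?thesis using finsum_fibre_sum[OF assms, of E] by simp
qed

lemma fibre_sum_id:
  assumes "f \<in> D \<rightarrow>\<^sub>E carrier G"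
  shows "fibre_sum G D D (\<lambda>a\<in>D. a) f = f"
proof
  fix b
  show "fibre_sum G D D (\<lambda>a\<in>D. a) f b = f b"
  proof (cases "b \<in> D")
    case True
    then have "{a \<in> D. (\<lambda>a\<in>D. a) a = b} = {b}" by auto
    moreover have "(\<Oplus>a\<in>{b}. f a) = f b" 
      using PiE_mem[OF assms True] finsum_insert[of "{}" b f] by simp
    ultimately show ?thesis using True by (simp add: fibre_sum_def)
  next
    case False
    then show ?thesis using assms by (auto simp: fibre_sum_def PiE_def extensional_def)
  qed
qed

lemma fibre_sum_compose:
  assumes "finite D" "finite E" "\<alpha> \<in> D \<rightarrow>\<^sub>E E" "f \<in> D \<rightarrow> carrier G"
  shows "fibre_sum G D F (compose D \<beta> \<alpha>) f = fibre_sum G E F \<beta> (fibre_sum G D E \<alpha> f)"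
proof
  fix c
  have "(\<Oplus>b\<in>{b \<in> E. \<beta> b = c}. fibre_sum G D E \<alpha> f b) = (\<Oplus>a\<in>{a \<in> D. \<alpha> a \<in> {b \<in> E. \<beta> b = c}}. f a)"
    by (rule finsum_fibre_sum) (use assms in auto)
  also have "{a \<in> D. \<alpha> a \<in> {b \<in> E. \<beta> b = c}} = {a \<in> D. compose D \<beta> \<alpha> a = c}"
    using assms by (auto simp: compose_def)
  finally show "fibre_sum G D F (compose D \<beta> \<alpha>) f c = fibre_sum G E F \<beta> (fibre_sum G D E \<alpha> f) c"
    by (simp add: fibre_sum_def)
qed

end

lemma minion_Z_minion:
  assumes "m > 0"
  shows "minion (Z_minion m :: ('a, 'a \<Rightarrow> int) minion_data)"
proof -
  have bound: "1 + k mod int m \<le> int m" for k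
    using assms pos_mod_bound[of "int m" k] by linarith
  interpret abelian_monoid "residue_ring (int m)"
    by (rule abelian_monoidI)
       (use assms in \<open>auto simp: residue_ring_def mod_simps algebra_simps bound\<close>)
  show ?thesis
  proof
    fix D E :: "'a set" and \<alpha> f
    assume *: "finite D" "finite E" "\<alpha> \<in> D \<rightarrow>\<^sub>E E" "f \<in> obj (Z_minion m) D"
    then show "act (Z_minion m) D E \<alpha> f \<in> obj (Z_minion m) E"
      using finsum_fibre_sum_all[of D E \<alpha> f] fibre_sum_closed[of f D E \<alpha>]
      by (auto simp: Z_minion_def Let_def PiE_def)
  qed (auto simp: Z_minion_def Let_def intro!: fibre_sum_id fibre_sum_compose)
qed

lemma algebra_coord_space:
  assumes "p > 1"
  shows "algebra (residue_ring (int p)) (coord_space p N)"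
proof -
  interpret residues "int p" "residue_ring (int p)"
    by unfold_locales (use assms in simp_all)
  have ag: "abelian_group (coord_space p N)"
  proof (rule abelian_groupI)
    fix x assume x: "x \<in> carrier (coord_space p N)"
    let ?y = "\<lambda>j\<in>{..<N}. \<ominus>\<^bsub>residue_ring (int p)\<^esub> x j"
    have "?y \<in> carrier (coord_space p N)" "?y \<oplus>\<^bsub>coord_space p N\<^esub> x = \<zero>\<^bsub>coord_space p N\<^esub>"
      using x by (auto simp: coord_space_def Let_def PiE_def Pi_def l_neg intro!: restrict_ext)
    then show "\<exists>y\<in>carrier (coord_space p N). y \<oplus>\<^bsub>coord_space p N\<^esub> x = \<zero>\<^bsub>coord_space p N\<^esub>"
      by blast
  qed (auto simp: coord_space_def Let_def PiE_def Pi_def a_ac extensional_def fun_eq_iff)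
  have "cring (coord_space p N)"
    by (rule cringI[OF ag])
       (auto simp: coord_space_def Let_def PiE_def Pi_def extensional_def fun_eq_iff
         m_ac l_distr r_distr intro!: comm_monoidI)
  moreover have "module (residue_ring (int p)) (coord_space p N)"
    by (rule moduleI[OF is_cring ag])
       (auto simp: coord_space_def Let_def PiE_def Pi_def extensional_def fun_eq_iff
         m_ac l_distr r_distr)
  ultimately show ?thesis
    by (intro algebra.intro)
       (auto simp: algebra_axioms_def coord_space_def Let_def PiE_def Pi_def extensional_def
         fun_eq_iff m_assoc)
qed

lemma weight_add:
  assumes "p > 1" "u \<in> carrier (coord_space p N)" "v \<in> carrier (coord_space p N)"
  shows "weight p N (u \<oplus>\<^bsub>coord_space p N\<^esub> v) = weight p N u \<oplus>\<^bsub>residue_ring (int p)\<^esub> weight p N v"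
proof -
  interpret residues "int p" "residue_ring (int p)"
    by unfold_locales (use assms in simp_all)
  have uv: "u \<in> {..<N} \<rightarrow> carrier (residue_ring (int p))" "v \<in> {..<N} \<rightarrow> carrier (residue_ring (int p))"
    using assms by (auto simp: coord_space_def Let_def)
  have "weight p N (u \<oplus>\<^bsub>coord_space p N\<^esub> v)
      = (\<Oplus>\<^bsub>residue_ring (int p)\<^esub>j\<in>{..<N}. u j \<oplus>\<^bsub>residue_ring (int p)\<^esub> v j)"
    unfolding weight_def
    by (rule finsum_cong') (use uv in \<open>auto simp: coord_space_def Let_def\<close>)
  then show ?thesis using uv by (simp add: weight_def finsum_addf)
qed

lemma minion_V2_minion:
  assumes "prime p"
  shows "minion (V2_minion p :: ('a, 'a V2_elem) minion_data)"
proof -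
  have p: "p > 1" using assms by (rule prime_gt_1_nat)
  interpret residues "int p" "residue_ring (int p)"
    by unfold_locales (use p in simp_all)
  show ?thesis
  proof
    fix D E :: "'a set" and \<alpha> r
    assume fin: "finite D" "finite E" and \<alpha>: "\<alpha> \<in> D \<rightarrow>\<^sub>E E" and r: "r \<in> obj (V2_minion p) D"
    obtain N V i v where r_eq: "r = (N, V, i, v)" by (cases r) auto
    define W where "W = coord_space p N"
    define w where "w = weight p N"
    interpret W: algebra "residue_ring (int p)" W
      unfolding W_def by (rule algebra_coord_space[OF p])
    have V: "submodule V (residue_ring (int p)) W" and i: "i \<in> V" "i = \<one>\<^bsub>W\<^esub>" "w i = 1"
      and v: "v \<in> D \<rightarrow>\<^sub>E V" and s: "(\<Oplus>\<^bsub>W\<^esub>a\<in>D. v a) = i"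
      and orth: "\<And>a b. \<lbrakk>a \<in> D; b \<in> D; a \<noteq> b\<rbrakk> \<Longrightarrow> w (v a \<otimes>\<^bsub>W\<^esub> v b) = 0"
      and idem: "\<And>a. a \<in> D \<Longrightarrow> w (v a \<otimes>\<^bsub>W\<^esub> v a) = w (v a)"
      using r by (auto simp: V2_minion_def V2_set_def r_eq W_def w_def Let_def)
    have VW: "V \<subseteq> carrier W" using W.submoduleE(1)[OF V] .
    have vW: "v \<in> D \<rightarrow> carrier W" using v VW by auto
    have w_add: "w (x \<oplus>\<^bsub>W\<^esub> y) = w x \<oplus>\<^bsub>residue_ring (int p)\<^esub> w y" if "x \<in> carrier W" "y \<in> carrier W" for x y
      using weight_add[OF p] that by (simp add: W_def w_def)
    have w_zero: "w \<zero>\<^bsub>W\<^esub> = 0"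
    proof -
      have "w \<zero>\<^bsub>W\<^esub> = (\<Oplus>\<^bsub>residue_ring (int p)\<^esub>j\<in>{..<N}. \<zero>\<^bsub>residue_ring (int p)\<^esub>)"
        unfolding w_def weight_def W_def
        by (rule finsum_cong') (auto simp: coord_space_def Let_def)
      then show ?thesis by (simp only: finsum_zero) (simp add: res_zero_eq)
    qed
    define S where "S = (\<lambda>A. \<Oplus>\<^bsub>W\<^esub>a\<in>A. v a)"
    have S_W: "S A \<in> carrier W" if "A \<subseteq> D" for A
      unfolding S_def by (rule W.finsum_closed) (use vW that in auto)
    have S_V: "S A \<in> V" if "A \<subseteq> D" for A
    proof -
      have "finite A" using that fin finite_subset by blast
      then show ?thesis using that
      proof (induction A)
        case empty
        have "\<zero>\<^bsub>W\<^esub> \<in> V" using V subgroup.one_closed[of V "add_monoid W"]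
          by (simp add: submodule_def)
        then show ?case by (simp add: S_def)
      next
        case (insert a A)
        then have "S (insert a A) = v a \<oplus>\<^bsub>W\<^esub> S A"
          unfolding S_def by (intro W.finsum_insert) (use vW in auto)
        then show ?case using insert v W.submoduleE(5)[OF V, of "v a" "S A"] by auto
      qed
    qed
    have S_insert: "S (insert a A) = v a \<oplus>\<^bsub>W\<^esub> S A" if "insert a A \<subseteq> D" "a \<notin> A" for a A
      unfolding S_def by (intro W.finsum_insert) (use vW that fin finite_subset in auto)
    have orth1: "w (v b \<otimes>\<^bsub>W\<^esub> S A) = 0" if "A \<subseteq> D" "b \<in> D" "b \<notin> A" for A b
    proof -
      have "finite A" using that fin finite_subset by blast
      then show ?thesis using that
      proof (induction A)
        case empty
        have "v b \<in> carrier W" using vW empty by auto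
        then show ?case by (simp add: S_def w_zero)
      next
        case (insert a A)
        have c: "v a \<in> carrier W" "v b \<in> carrier W" "S A \<in> carrier W"
          using vW insert S_W[of A] by auto
        have "v b \<otimes>\<^bsub>W\<^esub> S (insert a A) = v b \<otimes>\<^bsub>W\<^esub> v a \<oplus>\<^bsub>W\<^esub> v b \<otimes>\<^bsub>W\<^esub> S A"
          using insert c by (simp add: S_insert W.r_distr)
        then show ?case using insert c orth[of b a] by (auto simp: w_add res_add_eq)
      qed
    qed
    have orthS: "w (S B \<otimes>\<^bsub>W\<^esub> S A) = 0" if "A \<subseteq> D" "B \<subseteq> D" "A \<inter> B = {}" for A B
    proof -
      have "finite B" using that fin finite_subset by blast
      then show ?thesis using that
      proof (induction B)
        case empty
        then show ?case using S_W[of A] by (simp add: S_def w_zero)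
      next
        case (insert b B)
        have c: "v b \<in> carrier W" "S B \<in> carrier W" "S A \<in> carrier W"
          using vW insert S_W[of A] S_W[of B] by auto
        have "S (insert b B) \<otimes>\<^bsub>W\<^esub> S A = v b \<otimes>\<^bsub>W\<^esub> S A \<oplus>\<^bsub>W\<^esub> S B \<otimes>\<^bsub>W\<^esub> S A"
          using insert c by (simp add: S_insert W.l_distr)
        then show ?case using insert c orth1[of A b] by (auto simp: w_add res_add_eq)
      qed
    qed
    have idemS: "w (S A \<otimes>\<^bsub>W\<^esub> S A) = w (S A)" if "A \<subseteq> D" for A
    proof -
      have "finite A" using that fin finite_subset by blast
      then show ?thesis using that
      proof (induction A)
        case empty
        then show ?case by (simp add: S_def)
      next
        case (insert a A)
        have c: "v a \<in> carrier W" "S A \<in> carrier W"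
          using vW insert S_W[of A] by auto
        have "S (insert a A) \<otimes>\<^bsub>W\<^esub> S (insert a A) =
          (v a \<otimes>\<^bsub>W\<^esub> v a \<oplus>\<^bsub>W\<^esub> v a \<otimes>\<^bsub>W\<^esub> S A) \<oplus>\<^bsub>W\<^esub> (v a \<otimes>\<^bsub>W\<^esub> S A \<oplus>\<^bsub>W\<^esub> S A \<otimes>\<^bsub>W\<^esub> S A)"
          using insert c by (simp add: S_insert W.l_distr W.r_distr W.m_comm[of "S A" "v a"])
        then show ?case using insert c orth1[of A a] idem[of a]
          by (simp add: w_add S_insert res_add_eq mod_simps)
      qed
    qed
    have fib: "fibre_sum W D E \<alpha> v b = S {a \<in> D. \<alpha> a = b}" if "b \<in> E" for b
      using that by (simp add: fibre_sum_def S_def)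
    have "fibre_sum W D E \<alpha> v \<in> E \<rightarrow>\<^sub>E V"
      using S_V by (auto simp: fibre_sum_def S_def)
    moreover have "(\<Oplus>\<^bsub>W\<^esub>b\<in>E. fibre_sum W D E \<alpha> v b) = i"
      using W.finsum_fibre_sum_all[of D E \<alpha> v] fin \<alpha> vW s by auto
    moreover have "w (fibre_sum W D E \<alpha> v b \<otimes>\<^bsub>W\<^esub> fibre_sum W D E \<alpha> v c) = 0"
      if "b \<in> E" "c \<in> E" "b \<noteq> c" for b c
      using that by (auto simp: fib intro!: orthS)
    moreover have "w (fibre_sum W D E \<alpha> v b \<otimes>\<^bsub>W\<^esub> fibre_sum W D E \<alpha> v b) = w (fibre_sum W D E \<alpha> v b)"
      if "b \<in> E" for b
      using that by (auto simp: fib intro!: idemS)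
    ultimately show "act (V2_minion p) D E \<alpha> r \<in> obj (V2_minion p) E"
      using V i by (auto simp: V2_minion_def V2_set_def r_eq W_def w_def Let_def)
  next
    fix D :: "'a set" and r assume *: "finite D" "r \<in> obj (V2_minion p) D"
    obtain N V i v where r: "r = (N, V, i, v)" by (cases r) auto
    interpret W: algebra "residue_ring (int p)" "coord_space p N"
      by (rule algebra_coord_space[OF p])
    show "act (V2_minion p) D D (\<lambda>a\<in>D. a) r = r"
      using * W.submoduleE(1)[of V]
      by (auto simp: r V2_minion_def V2_set_def Let_def intro!: W.fibre_sum_id)
  next
    fix D E F :: "'a set" and \<alpha> \<beta> r
    assume *: "finite D" "finite E" "finite F" "\<alpha> \<in> D \<rightarrow>\<^sub>E E" "\<beta> \<in> E \<rightarrow>\<^sub>E F" "r \<in> obj (V2_minion p) D"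
    obtain N V i v where r: "r = (N, V, i, v)" by (cases r) auto
    interpret W: algebra "residue_ring (int p)" "coord_space p N"
      by (rule algebra_coord_space[OF p])
    show "act (V2_minion p) D F (compose D \<beta> \<alpha>) r
        = act (V2_minion p) E F \<beta> (act (V2_minion p) D E \<alpha> r)"
      using * W.submoduleE(1)[of V]
      by (auto simp: r V2_minion_def V2_set_def Let_def intro!: W.fibre_sum_compose)
  qed
qed

end

theory Submission
  imports Defs "HOL-Combinatorics.Permutations"
begin

text \<open>
  Take \<open>N = 4p + 1\<close> and \<open>V = Z\<^sub>p\<^sup>N\<close>. A homomorphism \<open>\<xi>\<close> assigns to every vector \<open>z\<close>
  with \<open>z \<cdot> z = z \<cdot> 1\<close> the first component \<open>g z\<close> of the value of \<open>\<xi>\<close> at the pair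
  \<open>(z, 1 - z)\<close>; naturality at triples \<open>(y, z, 1 - y - z)\<close> makes \<open>g\<close> additive on orthogonal
  pairs, and \<open>g 1 = 1\<close>. If \<open>z \<cdot> z = z \<cdot> 1 = 0\<close>, then \<open>z\<close> is orthogonal to its multiples, so
  \<open>p g(z) = g(p z) = 0\<close>. It therefore suffices to find a unit vector \<open>e\<^sub>k\<close> with \<open>p g(e\<^sub>k) = 0\<close>,
  because \<open>1 - e\<^sub>k\<close> is such a \<open>z\<close> and then \<open>p = p g(1) = 0\<close> modulo \<open>p\<^sup>2\<close>. To this end,
  let \<open>w\<close> have the entries \<open>0, \<dots>, p - 1\<close> on the first \<open>p\<close> coordinates. Adding 1 to these
  coordinates is an orthogonal addition, but also a cyclic shift of the entries, hence a product
  of transpositions. Each transposition is realised by orthogonal additions of multiples of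
  indicators of \<open>p\<close>-element sets, and comparing the two ways of computing \<open>g\<close> leaves exactly
  \<open>p g(e\<^sub>k) = 0\<close> for \<open>k = p - 1\<close>.
\<close>

section \<open>Vectors over \<open>Z_p\<close> given by integer representatives\<close>

definition vec :: "nat \<Rightarrow> nat \<Rightarrow> (nat \<Rightarrow> int) \<Rightarrow> nat \<Rightarrow> int" where
  "vec p N z = (\<lambda>j\<in>{..<N}. z j mod int p)"

text \<open>With the whole coordinate space as subspace, every tuple of vectors has its entries in
  it, and the subspace stays the same under all maps of the minion.\<close>

definition V2_full :: "nat \<Rightarrow> nat \<Rightarrow> 'a set \<Rightarrow> ('a \<Rightarrow> nat \<Rightarrow> int) \<Rightarrow> 'a V2_elem" where
  "V2_full p N D z =
     (N, carrier (coord_space p N), \<one>\<^bsub>coord_space p N\<^esub>, \<lambda>a\<in>D. vec p N (z a))"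

lemma finsum_residue_ring:
  assumes "m > 1" "finite A"
  shows "(\<Oplus>\<^bsub>residue_ring m\<^esub>a\<in>A. f a mod m) = (\<Sum>a\<in>A. f a) mod m"
proof -
  interpret residues m "residue_ring m"
    by unfold_locales (use assms in simp_all)
  have c: "k mod m \<in> carrier (residue_ring m)" for k
    using assms by (simp add: res_carrier_eq)
  show ?thesis
    using assms(2)
  proof (induction A)
    case empty
    then show ?case by (simp add: res_zero_eq)
  next
    case (insert a A)
    then have "(\<Oplus>\<^bsub>residue_ring m\<^esub>b\<in>insert a A. f b mod m)
        = f a mod m \<oplus>\<^bsub>residue_ring m\<^esub> (\<Oplus>\<^bsub>residue_ring m\<^esub>b\<in>A. f b mod m)"
      by (intro finsum_insert) (use c in auto)
    then show ?case using insert by (simp add: res_add_eq mod_simps)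
  qed
qed

lemma vec_closed: "p > 1 \<Longrightarrow> vec p N z \<in> carrier (coord_space p N)"
  by (auto simp: vec_def coord_space_def residue_ring_def Let_def)

lemma vec_eqI:
  assumes "\<And>j. j < N \<Longrightarrow> [y j = z j] (mod int p)"
  shows "vec p N y = vec p N z"
  using assms by (auto simp: vec_def cong_def)

lemma vec_mult: "vec p N y \<otimes>\<^bsub>coord_space p N\<^esub> vec p N z = vec p N (\<lambda>j. y j * z j)"
  by (auto simp: vec_def coord_space_def residue_ring_def Let_def mod_simps)

lemma vec_add: "vec p N y \<oplus>\<^bsub>coord_space p N\<^esub> vec p N z = vec p N (\<lambda>j. y j + z j)"
  by (auto simp: vec_def coord_space_def residue_ring_def Let_def mod_simps)

lemma vec_one: "p > 1 \<Longrightarrow> vec p N (\<lambda>j. 1) = \<one>\<^bsub>coord_space p N\<^esub>"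
  by (auto simp: vec_def coord_space_def residue_ring_def Let_def)

lemma vec_zero: "vec p N (\<lambda>j. 0) = \<zero>\<^bsub>coord_space p N\<^esub>"
  by (auto simp: vec_def coord_space_def residue_ring_def Let_def)

lemma weight_vec: "p > 1 \<Longrightarrow> weight p N (vec p N z) = (\<Sum>j<N. z j) mod int p"
proof -
  assume p: "p > 1"
  interpret residues "int p" "residue_ring (int p)"
    by unfold_locales (use p in simp_all)
  have "weight p N (vec p N z) = (\<Oplus>\<^bsub>residue_ring (int p)\<^esub>j\<in>{..<N}. z j mod int p)"
    unfolding weight_def by (rule finsum_cong') (use p in \<open>auto simp: vec_def res_carrier_eq\<close>)
  then show ?thesis using p by (simp add: finsum_residue_ring)
qed

lemma finsum_vec:
  assumes "p > 1" "finite A"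
  shows "(\<Oplus>\<^bsub>coord_space p N\<^esub>a\<in>A. vec p N (z a)) = vec p N (\<lambda>j. \<Sum>a\<in>A. z a j)"
proof -
  interpret W: algebra "residue_ring (int p)" "coord_space p N"
    by (rule algebra_coord_space[OF assms(1)])
  show ?thesis
    using assms(2)
  proof (induction A)
    case empty
    then show ?case by (simp add: vec_zero)
  next
    case (insert a A)
    then have "(\<Oplus>\<^bsub>coord_space p N\<^esub>b\<in>insert a A. vec p N (z b))
        = vec p N (z a) \<oplus>\<^bsub>coord_space p N\<^esub> (\<Oplus>\<^bsub>coord_space p N\<^esub>b\<in>A. vec p N (z b))"
      by (intro W.finsum_insert) (use vec_closed assms in auto)
    then show ?case using insert by (simp add: vec_add)
  qed
qed

lemma finsum_restrict_vec:
  assumes "p > 1" "finite D" "S \<subseteq> D"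
  shows "finsum (coord_space p N) (\<lambda>a\<in>D. vec p N (z a)) S = vec p N (\<lambda>j. \<Sum>a\<in>S. z a j)"
proof -
  interpret W: algebra "residue_ring (int p)" "coord_space p N"
    by (rule algebra_coord_space[OF assms(1)])
  have "finsum (coord_space p N) (\<lambda>a\<in>D. vec p N (z a)) S
      = (\<Oplus>\<^bsub>coord_space p N\<^esub>a\<in>S. vec p N (z a))"
    by (rule W.finsum_cong') (use assms vec_closed in auto)
  then show ?thesis using assms finite_subset[of S D] by (simp add: finsum_vec)
qed

lemma submodule_carrier_coord_space:
  assumes "p > 1"
  shows "submodule (carrier (coord_space p N)) (residue_ring (int p)) (coord_space p N)"
proof -
  interpret W: algebra "residue_ring (int p)" "coord_space p N"
    by (rule algebra_coord_space[OF assms])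
  show ?thesis
    by (rule W.module_incl_imp_submodule) (simp_all add: W.module_axioms)
qed

lemma V2_full_cong:
  assumes "\<And>a j. \<lbrakk>a \<in> D; j < N\<rbrakk> \<Longrightarrow> [y a j = z a j] (mod int p)"
  shows "V2_full p N D y = V2_full p N D z"
  using assms by (auto simp: V2_full_def intro!: restrict_ext vec_eqI)

text \<open>Turns membership into congruences between integer sums; the one on \<open>N\<close> says
  that the all-ones vector has weight 1.\<close>

lemma V2_full_mem:
  assumes p: "p > 1" and fin: "finite D" and N: "[int N = 1] (mod int p)"
    and s: "\<And>j. j < N \<Longrightarrow> [(\<Sum>a\<in>D. z a j) = 1] (mod int p)"
    and orth: "\<And>a b. \<lbrakk>a \<in> D; b \<in> D; a \<noteq> b\<rbrakk> \<Longrightarrow> [(\<Sum>j<N. z a j * z b j) = 0] (mod int p)"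
    and idem: "\<And>a. a \<in> D \<Longrightarrow> [(\<Sum>j<N. z a j * z a j) = (\<Sum>j<N. z a j)] (mod int p)"
  shows "V2_full p N D z \<in> V2_set p D"
proof -
  have "finsum (coord_space p N) (\<lambda>a\<in>D. vec p N (z a)) D = \<one>\<^bsub>coord_space p N\<^esub>"
    using s vec_eqI[of N "\<lambda>j. \<Sum>a\<in>D. z a j" "\<lambda>j. 1" p]
    by (simp only: finsum_restrict_vec[OF p fin subset_refl] vec_one[OF p])
  moreover have "weight p N \<one>\<^bsub>coord_space p N\<^esub> = 1"
    using p N by (simp add: vec_one[symmetric] weight_vec cong_def)
  moreover have "\<one>\<^bsub>coord_space p N\<^esub> \<in> carrier (coord_space p N)"
    using vec_closed[OF p] vec_one[OF p] by metis
  ultimately show ?thesis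
    unfolding V2_set_def V2_full_def Let_def mem_Collect_eq prod.case
    using p orth idem submodule_carrier_coord_space[OF p]
    by (intro conjI ballI impI) (simp_all add: vec_mult weight_vec cong_def vec_closed)
qed

lemma act_V2_full:
  assumes "p > 1" "finite D"
  shows "act (V2_minion p) D E \<alpha> (V2_full p N D z)
    = V2_full p N E (\<lambda>b j. \<Sum>a\<in>{a \<in> D. \<alpha> a = b}. z a j)"
  using assms
  by (auto simp: V2_minion_def V2_full_def fibre_sum_def finsum_restrict_vec simp del: restrict_apply
      intro!: restrict_ext)

section \<open>Homomorphisms into \<open>Z_minion m\<close> as integer congruences\<close>

lemma hom_Z_minion_act:
  assumes m: "m > 1" and hom: "minion_hom R (Z_minion m) \<xi>"
    and "finite D" "finite E" "\<alpha> \<in> D \<rightarrow>\<^sub>E E" "r \<in> obj R D" "b \<in> E"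
  shows "\<xi> E (act R D E \<alpha> r) b = (\<Sum>a\<in>{a \<in> D. \<alpha> a = b}. \<xi> D r a) mod int m"
proof -
  interpret residues "int m" "residue_ring (int m)"
    by unfold_locales (use m in simp_all)
  have "\<xi> D r \<in> obj (Z_minion m) D"
    using assms by (auto simp: minion_hom_def)
  then have c: "\<xi> D r a \<in> carrier (residue_ring (int m))" if "a \<in> D" for a
    using that by (auto simp: Z_minion_def Let_def)
  have "\<xi> E (act R D E \<alpha> r) b = (\<Oplus>\<^bsub>residue_ring (int m)\<^esub>a\<in>{a \<in> D. \<alpha> a = b}. \<xi> D r a)"
    using assms by (auto simp: minion_hom_def Z_minion_def Let_def fibre_sum_def)
  \<comment> \<open>The values of \<open>\<xi>\<close> are already reduced; writing the reduction
    out makes \<open>finsum_residue_ring\<close> applicable.\<close>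
  also have "\<dots> = (\<Oplus>\<^bsub>residue_ring (int m)\<^esub>a\<in>{a \<in> D. \<alpha> a = b}. \<xi> D r a mod int m)"
    by (rule finsum_cong') (use c m in \<open>auto simp: res_carrier_eq\<close>)
  also have "\<dots> = (\<Sum>a\<in>{a \<in> D. \<alpha> a = b}. \<xi> D r a) mod int m"
    using assms by (simp add: finsum_residue_ring)
  finally show ?thesis .
qed

lemma hom_Z_minion_sum:
  assumes m: "m > 1" and hom: "minion_hom R (Z_minion m) \<xi>" and "finite D" "r \<in> obj R D"
  shows "[(\<Sum>a\<in>D. \<xi> D r a) = 1] (mod int m)"
proof -
  interpret residues "int m" "residue_ring (int m)"
    by unfold_locales (use m in simp_all)
  have *: "\<xi> D r \<in> obj (Z_minion m) D"
    using assms by (auto simp: minion_hom_def)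
  then have c: "\<xi> D r a \<in> carrier (residue_ring (int m))" if "a \<in> D" for a
    using that by (auto simp: Z_minion_def Let_def)
  have "(\<Oplus>\<^bsub>residue_ring (int m)\<^esub>a\<in>D. \<xi> D r a) = (\<Oplus>\<^bsub>residue_ring (int m)\<^esub>a\<in>D. \<xi> D r a mod int m)"
    by (rule finsum_cong') (use c m in \<open>auto simp: res_carrier_eq\<close>)
  then show ?thesis
    using * assms by (simp add: Z_minion_def Let_def finsum_residue_ring cong_def)
qed

section \<open>From a homomorphism to an orthogonally additive function\<close>

text \<open>
  The vectors of \<open>Z\<^sub>p\<^sup>N\<close> are represented by integer functions, of which only the residues
  modulo \<open>p\<close> of the values below \<open>N\<close> matter.
\<close>

locale orthogonally_additive =
  fixes p N :: nat and m :: int and g :: "(nat \<Rightarrow> int) \<Rightarrow> int" and Q :: "(nat \<Rightarrow> int) \<Rightarrow> bool"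
  defines "Q z \<equiv> [(\<Sum>j<N. z j * z j) = (\<Sum>j<N. z j)] (mod int p)"
  assumes g_cong: "(\<And>j. j < N \<Longrightarrow> [y j = z j] (mod int p)) \<Longrightarrow> g y = g z"
    and g_add: "\<lbrakk>Q y; Q z; [(\<Sum>j<N. y j * z j) = 0] (mod int p)\<rbrakk>
      \<Longrightarrow> [g (\<lambda>j. y j + z j) = g y + g z] (mod m)"
    and g_one: "[g (\<lambda>j. 1) = 1] (mod m)"

lemma orthogonally_additive_if_hom:
  fixes \<xi> :: "'a::infinite set \<Rightarrow> 'a V2_elem \<Rightarrow> 'a \<Rightarrow> int"
  assumes p: "p > 1" and m: "m > 1" and hom: "minion_hom (V2_minion p) (Z_minion m) \<xi>"
    and N: "[int N = 1] (mod int p)"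
  shows "\<exists>g. orthogonally_additive p N (int m) g"
proof -
  obtain A :: "'a set" where "card A = 3" "finite A"
    using infinite_arbitrarily_large[OF infinite_UNIV, of 3] by blast
  then obtain a b c :: 'a where ab: "a \<noteq> b" "b \<noteq> c" "a \<noteq> c"
    by (auto simp: card_3_iff)
  \<comment> \<open>The pair belongs to \<open>V2_set\<close> only if \<open>z\<close> satisfies the
    condition \<open>Q\<close> of the locale. For other \<open>z\<close> the value of
    \<open>g\<close> is arbitrary, and only its dependence on residues is claimed there.\<close>
  define pair where "pair z = V2_full p N {a, b} (\<lambda>d. if d = a then z else (\<lambda>j. 1 - z j))" for z
  define g where "g z = \<xi> {a, b} (pair z) a" for z
  have obj: "obj (V2_minion p :: ('a, 'a V2_elem) minion_data) = V2_set p"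
    by (simp add: V2_minion_def)
  have push: "\<xi> E (V2_full p N E (\<lambda>b j. \<Sum>a\<in>{a \<in> D. \<alpha> a = b}. z a j)) b
      = (\<Sum>a\<in>{a \<in> D. \<alpha> a = b}. \<xi> D (V2_full p N D z) a) mod int m"
    if "finite D" "finite E" "\<alpha> \<in> D \<rightarrow>\<^sub>E E" "V2_full p N D z \<in> V2_set p D" "b \<in> E" for D E \<alpha> z b
    using hom_Z_minion_act[OF m hom, of D E \<alpha> "V2_full p N D z" b] that p
    by (simp add: act_V2_full obj)
  show ?thesis
  proof (intro exI[of _ g] orthogonally_additive.intro)
    fix y z :: "nat \<Rightarrow> int" assume "\<And>j. j < N \<Longrightarrow> [y j = z j] (mod int p)"
    then have "pair y = pair z"
      unfolding pair_def by (intro V2_full_cong) (auto intro: cong_diff)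
    then show "g y = g z" by (simp add: g_def)
  next
    fix y z :: "nat \<Rightarrow> int"
    assume y: "[(\<Sum>j<N. y j * y j) = (\<Sum>j<N. y j)] (mod int p)"
      and z: "[(\<Sum>j<N. z j * z j) = (\<Sum>j<N. z j)] (mod int p)"
      and yz: "[(\<Sum>j<N. y j * z j) = 0] (mod int p)"
    define D where "D = {a, b, c}"
    define v where "v = (\<lambda>d. if d = a then y else if d = b then z else (\<lambda>j. 1 - y j - z j))"
    define f where "f = \<xi> D (V2_full p N D v)"
    have fin: "finite D" by (simp add: D_def)
    have mem: "V2_full p N D v \<in> V2_set p D"
    proof (rule V2_full_mem[OF p fin N])
      fix j
      show "[(\<Sum>a\<in>D. v a j) = 1] (mod int p)"
        using ab by (simp add: D_def v_def)
    next
      have yc: "[(\<Sum>j<N. y j * (1 - y j - z j)) = 0] (mod int p)"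
      proof -
        have "(\<Sum>j<N. y j * (1 - y j - z j)) = (\<Sum>j<N. y j) - (\<Sum>j<N. y j * y j) - (\<Sum>j<N. y j * z j)"
          by (simp add: algebra_simps sum_subtractf sum.distrib)
        also have "[\<dots> = (\<Sum>j<N. y j) - (\<Sum>j<N. y j) - 0] (mod int p)"
          by (intro cong_diff y yz cong_refl)
        finally show ?thesis by simp
      qed
      have zc: "[(\<Sum>j<N. z j * (1 - y j - z j)) = 0] (mod int p)"
      proof -
        have "(\<Sum>j<N. z j * (1 - y j - z j)) = (\<Sum>j<N. z j) - (\<Sum>j<N. z j * z j) - (\<Sum>j<N. y j * z j)"
          by (simp add: algebra_simps sum_subtractf sum.distrib)
        also have "[\<dots> = (\<Sum>j<N. z j) - (\<Sum>j<N. z j) - 0] (mod int p)"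
          by (intro cong_diff z yz cong_refl)
        finally show ?thesis by simp
      qed
      fix d e assume "d \<in> D" "e \<in> D" "d \<noteq> e"
      then show "[(\<Sum>j<N. v d j * v e j) = 0] (mod int p)"
        using ab yz yc zc by (auto simp: D_def v_def mult.commute)
    next
      have cc: "[(\<Sum>j<N. (1 - y j - z j) * (1 - y j - z j)) = (\<Sum>j<N. 1 - y j - z j)] (mod int p)"
      proof -
        have "(\<Sum>j<N. (1 - y j - z j) * (1 - y j - z j))
          = (\<Sum>j<N. 1 - y j - z j) + ((\<Sum>j<N. y j * y j) - (\<Sum>j<N. y j))
            + ((\<Sum>j<N. z j * z j) - (\<Sum>j<N. z j)) + 2 * (\<Sum>j<N. y j * z j)"
          by (simp add: algebra_simps sum_subtractf sum.distrib sum_distrib_left)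
        also have "[\<dots> = (\<Sum>j<N. 1 - y j - z j) + ((\<Sum>j<N. y j) - (\<Sum>j<N. y j))
            + ((\<Sum>j<N. z j) - (\<Sum>j<N. z j)) + 2 * 0] (mod int p)"
          by (intro cong_add cong_diff cong_mult y z yz cong_refl)
        finally show ?thesis by simp
      qed
      fix d assume "d \<in> D"
      then show "[(\<Sum>j<N. v d j * v d j) = (\<Sum>j<N. v d j)] (mod int p)"
        using y z cc by (auto simp: D_def v_def)
    qed
    \<comment> \<open>Send \<open>S\<close> to \<open>a\<close> and the rest to \<open>b\<close>.
      The three vectors add up to 1, so the image of the triple is the pair of the sum over
      \<open>S\<close>. The sets \<open>{a}\<close>, \<open>{b}\<close> and \<open>{a, b}\<close>
      then give \<open>g y\<close>, \<open>g z\<close> and the value of \<open>g\<close> at the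
      sum.\<close>
    have pair_D: "g (\<lambda>j. \<Sum>d\<in>S. v d j) = (\<Sum>d\<in>S. f d) mod int m" if S: "S \<subseteq> D" for S
    proof -
      define \<alpha> where "\<alpha> = (\<lambda>d\<in>D. if d \<in> S then a else b)"
      have Sa: "{d \<in> D. \<alpha> d = a} = S" and Sb: "{d \<in> D. \<alpha> d = b} = D - S"
        using S ab by (auto simp: \<alpha>_def split: if_splits)
      have "\<alpha> \<in> D \<rightarrow>\<^sub>E {a, b}" by (auto simp: \<alpha>_def)
      have tot: "(\<Sum>d\<in>D. v d j) = 1" for j
        using ab by (simp add: D_def v_def)
      have "(\<Sum>d\<in>D - S. v d j) = 1 - (\<Sum>d\<in>S. v d j)" for j
        using sum_diff[OF fin S, of "\<lambda>d. v d j"] tot by simp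
      then have "pair (\<lambda>j. \<Sum>d\<in>S. v d j) = V2_full p N {a, b} (\<lambda>e j. \<Sum>d\<in>{d \<in> D. \<alpha> d = e}. v d j)"
        unfolding pair_def using ab by (intro V2_full_cong) (auto simp: Sa Sb)
      then show ?thesis
        using push[OF fin, of "{a, b}" \<alpha> v a] mem Sa \<open>\<alpha> \<in> D \<rightarrow>\<^sub>E {a, b}\<close> by (simp add: g_def f_def)
    qed
    have "g y = f a mod int m" "g z = f b mod int m"
      using pair_D[of "{a}"] pair_D[of "{b}"] ab by (simp_all add: D_def v_def)
    moreover have "g (\<lambda>j. y j + z j) = (f a + f b) mod int m"
      using pair_D[of "{a, b}"] ab by (simp add: D_def v_def)
    ultimately show "[g (\<lambda>j. y j + z j) = g y + g z] (mod int m)"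
      by (simp add: cong_def mod_simps)
  next
    \<comment> \<open>The pair \<open>(1, 0)\<close> is the image of a tuple with the single entry
      1. There \<open>\<xi>\<close> has only one value, which must be 1 modulo
      \<open>m\<close>.\<close>
    define v where "v = (\<lambda>(d::'a) (j::nat). 1::int)"
    have mem: "V2_full p N {a} v \<in> V2_set p {a}"
      by (rule V2_full_mem[OF p _ N]) (auto simp: v_def)
    define \<alpha> where "\<alpha> = (\<lambda>d\<in>{a}. a)"
    have S: "{d \<in> {a}. \<alpha> d = a} = {a}" "{d \<in> {a}. \<alpha> d = b} = {}"
      using ab by (auto simp: \<alpha>_def)
    have "pair (\<lambda>j. 1) = V2_full p N {a, b} (\<lambda>e j. \<Sum>d\<in>{d \<in> {a}. \<alpha> d = e}. v d j)"
      unfolding pair_def using ab S by (intro V2_full_cong) (auto simp: v_def \<alpha>_def)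
    then have "g (\<lambda>j. 1) = \<xi> {a} (V2_full p N {a} v) a mod int m"
      using push[of "{a}" "{a, b}" \<alpha> v a] mem S by (simp add: g_def \<alpha>_def)
    then show "[g (\<lambda>j. 1) = 1] (mod int m)"
      using hom_Z_minion_sum[OF m hom, of "{a}" "V2_full p N {a} v"] mem
      by (simp add: obj cong_def)
  qed
qed

section \<open>Isotropic vectors and indicators\<close>

context orthogonally_additive
begin

text \<open>Both conditions are homogeneous and hence pass to multiples, which \<open>Q\<close> in
  general does not.\<close>

abbreviation isotropic :: "(nat \<Rightarrow> int) \<Rightarrow> bool" where
  "isotropic z \<equiv> [(\<Sum>j<N. z j * z j) = 0] (mod int p) \<and> [(\<Sum>j<N. z j) = 0] (mod int p)"

lemma Q_if_isotropic: "isotropic z \<Longrightarrow> Q z"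
  by (simp add: Q_def cong_def)

lemma g_zero: "[g (\<lambda>j. 0) = 0] (mod m)"
proof -
  have "[g (\<lambda>j. 0 + 0) = g (\<lambda>j. 0) + g (\<lambda>j. 0)] (mod m)"
    by (rule g_add) (auto simp: Q_def)
  then show ?thesis by (simp add: cong_iff_dvd_diff)
qed

lemma isotropic_scale:
  assumes "isotropic z"
  shows "isotropic (\<lambda>j. c * z j)"
proof -
  have "[c * c * (\<Sum>j<N. z j * z j) = c * c * 0] (mod int p)" "[c * (\<Sum>j<N. z j) = c * 0] (mod int p)"
    using assms by (blast intro: cong_scalar_left)+
  then show ?thesis by (simp add: sum_distrib_left mult_ac)
qed

text \<open>An isotropic vector is orthogonal to each of its multiples, so one more copy can be
  added at a time.\<close>

lemma g_scale:
  assumes z: "isotropic z"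
  shows "[g (\<lambda>j. int c * z j) = int c * g z] (mod m)"
proof (induction c)
  case 0
  then show ?case using g_zero by simp
next
  case (Suc c)
  have "[int c * (\<Sum>j<N. z j * z j) = int c * 0] (mod int p)"
    using z by (blast intro: cong_scalar_left)
  then have "[(\<Sum>j<N. int c * z j * z j) = 0] (mod int p)"
    by (simp add: sum_distrib_left mult_ac)
  then have "[g (\<lambda>j. int c * z j + z j) = g (\<lambda>j. int c * z j) + g z] (mod m)"
    using z isotropic_scale[OF z, of "int c"] by (intro g_add Q_if_isotropic) auto
  also have "[g (\<lambda>j. int c * z j) + g z = int c * g z + g z] (mod m)"
    by (intro cong_add Suc cong_refl)
  finally show ?case by (simp add: algebra_simps)
qed

lemma p_times_g_isotropic:
  assumes "isotropic z"
  shows "[int p * g z = 0] (mod m)"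
proof -
  have "g (\<lambda>j. int p * z j) = g (\<lambda>j. 0)"
    by (rule g_cong) (simp add: cong_def)
  then show ?thesis
    using g_scale[OF assms, of p] g_zero by (auto intro: cong_sym cong_trans)
qed

lemma sum_indicator:
  fixes f :: "nat \<Rightarrow> int"
  assumes "S \<subseteq> {..<N}"
  shows "(\<Sum>j<N. f j * of_bool (j \<in> S)) = (\<Sum>j\<in>S. f j)"
  using assms by (intro sum.mono_neutral_cong_right) auto

lemma Q_indicator: "Q (\<lambda>j. of_bool (j \<in> S))"
  by (simp add: Q_def flip: of_bool_conj)

text \<open>Both sums are equal to the cardinality of \<open>S\<close>.\<close>

lemma isotropic_indicator:
  assumes "S \<subseteq> {..<N}" "int p dvd int (card S)"
  shows "isotropic (\<lambda>j. of_bool (j \<in> S))"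
  using sum_indicator[OF assms(1), of "\<lambda>j. 1"] sum_indicator[OF assms(1), of "\<lambda>j. of_bool (j \<in> S)"] assms(2)
  by (simp add: cong_0_iff)

text \<open>Disjoint supports make the two indicators orthogonal.\<close>

lemma g_indicator_Un:
  assumes "S \<inter> T = {}"
  shows "[g (\<lambda>j. of_bool (j \<in> S \<union> T)) = g (\<lambda>j. of_bool (j \<in> S)) + g (\<lambda>j. of_bool (j \<in> T))] (mod m)"
proof -
  have "(\<lambda>j. of_bool (j \<in> S \<union> T)) = (\<lambda>j. of_bool (j \<in> S) + of_bool (j \<in> T) :: int)"
    using assms by (auto simp: fun_eq_iff)
  moreover have "(\<Sum>j<N. of_bool (j \<in> S) * of_bool (j \<in> T)) = (0 :: int)"
    using assms by (intro sum.neutral) auto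
  ultimately show ?thesis
    using g_add[OF Q_indicator[of S] Q_indicator[of T]] by simp
qed

lemma g_indicator:
  assumes "finite S"
  shows "[g (\<lambda>j. of_bool (j \<in> S)) = (\<Sum>k\<in>S. g (\<lambda>j. of_bool (j = k)))] (mod m)"
  using assms
proof (induction S)
  case empty
  then show ?case using g_zero by simp
next
  case (insert k S)
  then have "[g (\<lambda>j. of_bool (j \<in> {k} \<union> S)) = g (\<lambda>j. of_bool (j \<in> {k})) + g (\<lambda>j. of_bool (j \<in> S))] (mod m)"
    by (intro g_indicator_Un) auto
  also have "[g (\<lambda>j. of_bool (j \<in> {k})) + g (\<lambda>j. of_bool (j \<in> S))
      = g (\<lambda>j. of_bool (j = k)) + (\<Sum>k\<in>S. g (\<lambda>j. of_bool (j = k)))] (mod m)"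
    using cong_add[OF cong_refl insert.IH] by simp
  finally show ?case using insert by simp
qed

section \<open>The cyclic shift of the entries \<open>0, ..., p - 1\<close>\<close>

lemma p_cong_0:
  assumes p: "odd p" and N: "N = 4 * p + 1"
  shows "[int p = 0] (mod m)"
proof -
  have p0: "p > 0" using p by (cases p) auto
  define e :: "nat \<Rightarrow> nat \<Rightarrow> int" where "e k = (\<lambda>j. of_bool (j = k))" for k
  \<comment> \<open>These are \<open>p - 1\<close> spare coordinates beyond the three blocks of
    length \<open>p\<close>. One further coordinate \<open>k < p\<close> completes them to a set of
    size \<open>p\<close>, whose indicator \<open>A k\<close> is isotropic.\<close>
  define T where "T = {3 * p..<4 * p - 1}"
  define t where "t = g (\<lambda>j. of_bool (j \<in> T))"
  define A :: "nat \<Rightarrow> nat \<Rightarrow> int" where "A k = (\<lambda>j. of_bool (j \<in> insert k T))" for k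
  define w :: "nat \<Rightarrow> nat \<Rightarrow> int" where
    "w k = (\<lambda>j. if j < k then int j + 1 else if j = k then 0 else if j < 3 * p then int (j mod p) else 0)"
    for k
  \<comment> \<open>\<open>w k\<close> is \<open>w 0\<close> after the first \<open>k\<close> transpositions of the shift, which move the entry 0 to
    position \<open>k\<close>. The entries occur in three blocks so that \<open>w k\<close> is isotropic also for \<open>p = 3\<close>.\<close>
  have T_N: "insert k T \<subseteq> {..<N}" if "k < p" for k
    using that N by (auto simp: T_def)
  have A_iso: "isotropic (A k)" if "k < p" for k
  proof -
    have "k \<notin> T" using that by (auto simp: T_def)
    then have "card (insert k T) = p" using p0 by (simp add: T_def)
    then show ?thesis
      unfolding A_def using T_N[OF that] by (intro isotropic_indicator) auto
  qed
  have gA: "[g (A k) = g (e k) + t] (mod m)" if "k < p" for k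
    using g_indicator_Un[of "{k}" T] that by (simp add: A_def e_def t_def T_def)
  have w_Suc: "w (Suc k) = (\<lambda>j. w k (transpose k (Suc k) j))" if "Suc k < p" for k
    using that by (auto simp: w_def fun_eq_iff transpose_def)
  \<comment> \<open>A transposition of the entries preserves such sums. The cases where
    \<open>F\<close> is the identity or the square show that all \<open>w k\<close> are isotropic
    once \<open>w 0\<close> is.\<close>
  have sum_w_Suc: "(\<Sum>j<N. F (w (Suc k) j)) = (\<Sum>j<N. F (w k j))" if "Suc k < p" for k and F :: "int \<Rightarrow> int"
  proof -
    have "transpose k (Suc k) permutes {..<N}"
      using that N by (intro permutes_swap_id) auto
    then show ?thesis
      using that sum.permute[of "transpose k (Suc k)" "{..<N}" "\<lambda>j. F (w k j)"]
      by (simp add: w_Suc o_def)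
  qed
  have sum_w: "(\<Sum>j<N. F (w k j)) = (\<Sum>j<N. F (w 0 j))" if "k < p" for k and F :: "int \<Rightarrow> int"
    using that by (induction k) (auto simp: sum_w_Suc)
  \<comment> \<open>Since \<open>F 0 = 0\<close>, the coordinates from \<open>3 * p\<close> on
    contribute nothing.\<close>
  have sum_w0: "(\<Sum>j<N. F (w 0 j)) = 3 * (\<Sum>c<p. F (int c))" if "F 0 = 0" for F :: "int \<Rightarrow> int"
  proof -
    have "(\<Sum>j<N. F (w 0 j)) = (\<Sum>j<3 * p. F (int (j mod p)))"
      using N that by (intro sum.mono_neutral_cong_right) (auto simp: w_def)
    also have "\<dots> = (\<Sum>i<3. \<Sum>j\<in>{i * p..<i * p + p}. F (int (j mod p)))"
      by (rule sum.nat_group[symmetric])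
    also have "\<dots> = (\<Sum>i<(3::nat). \<Sum>c<p. F (int c))"
    proof (rule sum.cong[OF refl])
      fix i :: nat
      show "(\<Sum>j\<in>{i * p..<i * p + p}. F (int (j mod p))) = (\<Sum>c<p. F (int c))"
        using sum.shift_bounds_nat_ivl[of "\<lambda>j. F (int (j mod p))" 0 "i * p" p]
        by (simp add: add.commute lessThan_atLeast0)
    qed
    finally show ?thesis by simp
  qed
  have sum_c: "int p dvd (\<Sum>c<p. int c)"
  proof -
    obtain h where h: "int p = 2 * h + 1" using p by (metis even_of_nat oddE)
    have "2 * (\<Sum>c<n. int c) = int n * (int n - 1)" for n
      by (induction n) (auto simp: algebra_simps)
    from this[of p] have "(\<Sum>c<p. int c) = int p * h" using h by simp
    then show ?thesis by simp
  qed
  \<comment> \<open>Three times the sum of squares is \<open>p * (p - 1) * (2 * p - 1) / 2\<close>,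
    and \<open>p - 1\<close> is even.\<close>
  have sum_c2: "int p dvd 3 * (\<Sum>c<p. int c * int c)"
  proof -
    obtain h where h: "int p = 2 * h + 1" using p by (metis even_of_nat oddE)
    have "6 * (\<Sum>c<n. int c * int c) = int n * (int n - 1) * (2 * int n - 1)" for n
      by (induction n) (auto simp: algebra_simps)
    from this[of p] have "3 * (\<Sum>c<p. int c * int c) = int p * (h * (2 * int p - 1))" using h by simp
    then show ?thesis by simp
  qed
  have w_iso: "isotropic (w k)" if "k < p" for k
    using sum_w[OF that, of "\<lambda>x. x"] sum_w[OF that, of "\<lambda>x. x * x"] sum_w0[of "\<lambda>x. x"]
      sum_w0[of "\<lambda>x. x * x"] sum_c sum_c2 by (simp add: cong_0_iff)
  \<comment> \<open>The entry 0 of \<open>w k\<close> sits at position \<open>k\<close>, and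
    \<open>w k\<close> vanishes on \<open>T\<close>, so the supports are disjoint.\<close>
  have w_A: "(\<Sum>j<N. w k j * A k j) = 0" if "k < p" for k
  proof -
    have "(\<Sum>j<N. w k j * A k j) = (\<Sum>j\<in>insert k T. w k j)"
      unfolding A_def by (rule sum_indicator[OF T_N[OF that]])
    also have "\<dots> = 0" using that by (intro sum.neutral) (auto simp: w_def T_def)
    finally show ?thesis .
  qed
  have g_w_A: "[g (\<lambda>j. w k j + int c * A k j) = g (w k) + int c * (g (e k) + t)] (mod m)" if k: "k < p" for k c
  proof -
    have "(\<Sum>j<N. w k j * (int c * A k j)) = int c * (\<Sum>j<N. w k j * A k j)"
      by (simp add: sum_distrib_left mult_ac)
    then have "[(\<Sum>j<N. w k j * (int c * A k j)) = 0] (mod int p)"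
      by (simp add: w_A[OF k])
    then have "[g (\<lambda>j. w k j + int c * A k j) = g (w k) + g (\<lambda>j. int c * A k j)] (mod m)"
      by (intro g_add Q_if_isotropic w_iso isotropic_scale A_iso k)
    also have "[g (w k) + g (\<lambda>j. int c * A k j) = g (w k) + int c * g (A k)] (mod m)"
      by (intro cong_add cong_refl g_scale A_iso k)
    also have "[g (w k) + int c * g (A k) = g (w k) + int c * (g (e k) + t)] (mod m)"
      by (intro cong_add cong_mult cong_refl gA k)
    finally show ?thesis .
  qed
  have step: "[g (w (Suc k)) = g (w k) + int (Suc k) * (g (e k) - g (e (Suc k)))] (mod m)"
    if k: "Suc k < p" for k
  proof -
    \<comment> \<open>The entry to be exchanged with 0 is \<open>Suc k\<close>. Adding
      \<open>Suc k\<close> at the position of the 0, before or after the exchange, makes the entries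
      at \<open>k\<close> and \<open>Suc k\<close> both equal to \<open>Suc k\<close>. On
      \<open>T\<close> both sides gain the same amount, so the contribution of \<open>t\<close>
      cancels.\<close>
    have "(\<lambda>j. w k j + int (Suc k) * A k j) = (\<lambda>j. w (Suc k) j + int (Suc k) * A (Suc k) j)"
      using k by (auto simp: w_def A_def T_def fun_eq_iff)
    then have "[g (w k) + int (Suc k) * (g (e k) + t) = g (\<lambda>j. w (Suc k) j + int (Suc k) * A (Suc k) j)] (mod m)"
      using cong_sym[OF g_w_A[of k "Suc k"]] k by simp
    also note g_w_A[OF k, of "Suc k"]
    finally have "[g (w (Suc k)) + int (Suc k) * (g (e (Suc k)) + t) - int (Suc k) * (g (e (Suc k)) + t)
        = g (w k) + int (Suc k) * (g (e k) + t) - int (Suc k) * (g (e (Suc k)) + t)] (mod m)"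
      by (intro cong_diff cong_refl) (rule cong_sym)
    then show ?thesis by (simp add: algebra_simps)
  qed
  \<comment> \<open>Summation by parts of the differences in \<open>step\<close>.\<close>
  have telescope: "[g (w k) = g (w 0) + (\<Sum>i\<le>k. g (e i)) - int (Suc k) * g (e k)] (mod m)" if "k < p" for k
    using that
  proof (induction k)
    case 0
    then show ?case by simp
  next
    case (Suc k)
    note step[OF Suc.prems]
    also have "[g (w k) + int (Suc k) * (g (e k) - g (e (Suc k)))
        = (g (w 0) + (\<Sum>i\<le>k. g (e i)) - int (Suc k) * g (e k)) + int (Suc k) * (g (e k) - g (e (Suc k)))] (mod m)"
      by (intro cong_add cong_refl Suc) (use Suc in simp)
    finally show ?case by (simp add: algebra_simps)
  qed
  \<comment> \<open>After \<open>p - 1\<close> transpositions the first block reads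
    \<open>1, ..., p - 1, 0\<close>. This is the old block plus 1, where the last entry
    \<open>p\<close> has become 0 modulo \<open>p\<close>.\<close>
  have last: "g (w (p - 1)) = g (\<lambda>j. w 0 j + of_bool (j \<in> {..<p}))"
  proof (rule g_cong)
    fix j
    have "j < p - 1 \<or> j = p - 1 \<or> p - 1 < j" by auto
    then show "[w (p - 1) j = w 0 j + of_bool (j \<in> {..<p})] (mod int p)"
      using p0 by (auto simp: w_def of_nat_diff cong_def)
  qed
  have "[g (w (p - 1)) = g (w 0) + (\<Sum>k<p. g (e k))] (mod m)"
  proof -
    \<comment> \<open>The inner product is \<open>0 + ... + (p - 1)\<close>, a multiple of
      \<open>p\<close> because \<open>p\<close> is odd.\<close>
    have "(\<Sum>j<N. w 0 j * of_bool (j \<in> {..<p})) = (\<Sum>j<p. w 0 j)"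
      using N by (intro sum_indicator) auto
    also have "\<dots> = (\<Sum>c<p. int c)"
      by (rule sum.cong) (auto simp: w_def)
    finally have "[(\<Sum>j<N. w 0 j * of_bool (j \<in> {..<p})) = 0] (mod int p)"
      using sum_c by (simp add: cong_0_iff)
    then have "[g (w (p - 1)) = g (w 0) + g (\<lambda>j. of_bool (j \<in> {..<p}))] (mod m)"
      unfolding last using p0 by (intro g_add Q_indicator Q_if_isotropic w_iso)
    also have "[g (w 0) + g (\<lambda>j. of_bool (j \<in> {..<p})) = g (w 0) + (\<Sum>k<p. g (e k))] (mod m)"
      unfolding e_def by (intro cong_add cong_refl g_indicator) simp
    finally show ?thesis .
  qed
  moreover have "[g (w (p - 1)) = g (w 0) + (\<Sum>k<p. g (e k)) - int p * g (e (p - 1))] (mod m)"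
  proof -
    have "{..p - 1} = {..<p}" using p0 by auto
    then show ?thesis using telescope[of "p - 1"] p0 by simp
  qed
  ultimately have "[g (w 0) + (\<Sum>k<p. g (e k)) = g (w 0) + (\<Sum>k<p. g (e k)) - int p * g (e (p - 1))] (mod m)"
    by (blast intro: cong_sym cong_trans)
  \<comment> \<open>All other terms of the two computations agree, so the correction term left by
    the telescoping must vanish.\<close>
  then have pe: "[int p * g (e (p - 1)) = 0] (mod m)"
    by (simp add: cong_iff_dvd_diff)
  \<comment> \<open>The complement of one coordinate has \<open>4 * p\<close> elements, so its
    indicator is isotropic.\<close>
  define S where "S = {..<N} - {p - 1}"
  have pS: "[int p * g (\<lambda>j. of_bool (j \<in> S)) = 0] (mod m)"
    using N p0 by (intro p_times_g_isotropic isotropic_indicator) (auto simp: S_def card_Diff_singleton)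
  have "g (\<lambda>j. 1) = g (\<lambda>j. of_bool (j \<in> {p - 1} \<union> S))"
    by (rule g_cong) (auto simp: S_def)
  then have "[g (\<lambda>j. 1) = g (e (p - 1)) + g (\<lambda>j. of_bool (j \<in> S))] (mod m)"
    using g_indicator_Un[of "{p - 1}" S] by (simp add: e_def S_def)
  then have "[1 = g (e (p - 1)) + g (\<lambda>j. of_bool (j \<in> S))] (mod m)"
    using g_one by (blast intro: cong_sym cong_trans)
  then have "[int p * 1 = int p * (g (e (p - 1)) + g (\<lambda>j. of_bool (j \<in> S)))] (mod m)"
    by (rule cong_scalar_left)
  also have "[int p * (g (e (p - 1)) + g (\<lambda>j. of_bool (j \<in> S))) = 0] (mod m)"
    using cong_add[OF pe pS] by (simp add: distrib_left)
  finally show ?thesis by simp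
qed

end

section \<open>The contradiction modulo \<open>p ^ 2\<close>\<close>

theorem proposition4p8:
  fixes p :: nat
  assumes "prime p" and "p > 2"
  shows "\<nexists>\<xi>. minion_hom (V2_minion p :: ('a::infinite, 'a V2_elem) minion_data)
                        (Z_minion (p ^ 2)) \<xi>"
proof
  assume "\<exists>\<xi>. minion_hom (V2_minion p :: ('a, 'a V2_elem) minion_data) (Z_minion (p ^ 2)) \<xi>"
  then obtain \<xi> where hom: "minion_hom (V2_minion p :: ('a, 'a V2_elem) minion_data) (Z_minion (p ^ 2)) \<xi>" ..
  have "p ^ 2 > 1" using assms by (intro one_less_power) auto
  moreover have "[int (4 * p + 1) = 1] (mod int p)" by (simp add: cong_iff_dvd_diff)
  ultimately obtain g where "orthogonally_additive p (4 * p + 1) (int (p ^ 2)) g"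
    using orthogonally_additive_if_hom[OF _ _ hom] assms by fastforce
  moreover have "odd p" using assms prime_odd_nat by auto
  ultimately have "[int p = 0] (mod int (p ^ 2))"
    using orthogonally_additive.p_cong_0 by blast
  then have "p ^ 2 dvd p" by (simp add: cong_0_iff flip: int_dvd_int_iff)
  then show False using assms dvd_imp_le[of "p ^ 2" p] by (auto simp: power2_eq_square)
qed

end
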